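(* Let $a>0$ and let $\Theta\subseteq\mathbb{T}$ be non-empty. The exponential system $E(\mathbb{R})$ does $\Theta$-PR in $L^2[0,a]$ if and only if $\Theta$ is totally disconnected.
   Context: $\mathbb{T}=\{z\in\mathbb{C}:|z|=1\}$ with its usual topology; $\Theta$ carries the subspace topology. $L^2[0,a]$ is the Hilbert space of complex-valued square-integrable functions on $[0,a]$ with $\langle f,g\rangle=\int_0^a f(t)\overline{g(t)}\,dt$. For $\lambda\in\mathbb{R}$ let $e_\lambda(x)=e^{2\pi i\lambda x}$, and $E(\mathbb{R})=\{e_\lambda\}_{\lambda\in\mathbb{R}}$. For a Hilbert space $H$ and $\Theta\subseteq\mathbb{T}$, a set $\mathbf{G}\subseteq H$ does $\Theta$-PR in $H$ if for all $f,h\in H$ the following holds: if for every $g\in\mathbf{G}$ there exists $\theta_g\in\Theta$ with $\langle f,g\rangle=\theta_g\langle h,g\rangle$, then $f=\theta h$ for some $\theta\in\Theta$. *)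

theory Defs
  imports "HOL-Analysis.Analysis"
begin

text \<open>Phase retrieval only refers to the elements, the scalar multiplication and the inner
  product (linear in the first argument) of a Hilbert space, so these are the components recorded.\<close>

record 'v complex_space =
  elements :: "'v set"
  scalar_mult :: "complex \<Rightarrow> 'v \<Rightarrow> 'v"
  inner_prod :: "'v \<Rightarrow> 'v \<Rightarrow> complex"

definition does_PR :: "complex set \<Rightarrow> 'v complex_space \<Rightarrow> 'v set \<Rightarrow> bool" where
  "does_PR \<Theta> H G \<longleftrightarrow>
     (\<forall>f\<in>elements H. \<forall>h\<in>elements H.
        (\<forall>g\<in>G. \<exists>\<theta>\<in>\<Theta>. inner_prod H f g = \<theta> * inner_prod H h g)
        \<longrightarrow> (\<exists>\<theta>\<in>\<Theta>. f = scalar_mult H \<theta> h))"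

text \<open>The interval is a value, not a type, so \<open>L\<^sup>2[0,a]\<close> is built as a set of almost-everywhere
  equivalence classes of functions on the reals, of which only the values on \<open>[0,a]\<close> matter.\<close>

definition square_integrable_fun :: "real \<Rightarrow> (real \<Rightarrow> complex) set" where
  "square_integrable_fun a =
     {f. f \<in> borel_measurable (lebesgue_on {0..a}) \<and>
         integrable (lebesgue_on {0..a}) (\<lambda>t. (cmod (f t))\<^sup>2)}"

definition ae_eq :: "real \<Rightarrow> ((real \<Rightarrow> complex) \<times> (real \<Rightarrow> complex)) set" where
  "ae_eq a = {(f, g). f \<in> square_integrable_fun a \<and> g \<in> square_integrable_fun a \<and>
                      (AE t in lebesgue_on {0..a}. f t = g t)}"

definition L2_class :: "real \<Rightarrow> (real \<Rightarrow> complex) \<Rightarrow> (real \<Rightarrow> complex) set" where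
  "L2_class a f = ae_eq a `` {f}"

definition L2 :: "real \<Rightarrow> (real \<Rightarrow> complex) set complex_space" where
  "L2 a = \<lparr> elements = square_integrable_fun a // ae_eq a,
            scalar_mult = (\<lambda>c F. \<Union>f\<in>F. L2_class a (\<lambda>t. c * f t)),
            inner_prod = (\<lambda>F G. THE c. \<exists>f\<in>F. \<exists>g\<in>G.
               c = (LINT t|lebesgue_on {0..a}. f t * cnj (g t))) \<rparr>"

definition exponential :: "real \<Rightarrow> real \<Rightarrow> complex" where
  "exponential r x = exp (2 * of_real pi * \<i> * of_real r * of_real x)"

definition exponential_system :: "real \<Rightarrow> (real \<Rightarrow> complex) set set" where
  "exponential_system a = range (\<lambda>r. L2_class a (exponential r))"

definition totally_disconnected_space :: "'a topology \<Rightarrow> bool" where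
  "totally_disconnected_space X \<longleftrightarrow> (\<forall>S. connectedin X S \<longrightarrow> (\<exists>x. S \<subseteq> {x}))"

text \<open>The operations on classes are independent of the representatives.\<close>

lemma equiv_ae_eq: "equiv (square_integrable_fun a) (ae_eq a)"
proof (rule equivI)
  show "ae_eq a \<subseteq> square_integrable_fun a \<times> square_integrable_fun a"
    by (auto simp: ae_eq_def)
  show "refl_on (square_integrable_fun a) (ae_eq a)"
    by (auto simp: refl_on_def ae_eq_def)
  show "sym (ae_eq a)"
    by (rule symI) (simp add: ae_eq_def eq_commute)
  show "trans (ae_eq a)"
  proof (rule transI)
    fix f g h assume fg: "(f, g) \<in> ae_eq a" and gh: "(g, h) \<in> ae_eq a"
    then have "AE t in lebesgue_on {0..a}. f t = g t" "AE t in lebesgue_on {0..a}. g t = h t"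
      by (simp_all add: ae_eq_def)
    then have "AE t in lebesgue_on {0..a}. f t = h t"
      by eventually_elim simp
    with fg gh show "(f, h) \<in> ae_eq a"
      by (simp add: ae_eq_def)
  qed
qed

lemma L2_class_in_elements:
  "f \<in> square_integrable_fun a \<Longrightarrow> L2_class a f \<in> elements (L2 a)"
  by (simp add: L2_def L2_class_def quotientI)

lemma L2_class_eq_iff:
  assumes "f \<in> square_integrable_fun a" "g \<in> square_integrable_fun a"
  shows "L2_class a f = L2_class a g \<longleftrightarrow> (AE t in lebesgue_on {0..a}. f t = g t)"
  using assms eq_equiv_class_iff[OF equiv_ae_eq assms]
  by (simp add: L2_class_def ae_eq_def)

lemma L2_elementE:
  assumes "F \<in> elements (L2 a)"
  obtains f where "f \<in> square_integrable_fun a" "F = L2_class a f"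
  using assms by (auto simp: L2_def L2_class_def elim: quotientE)

lemma square_integrable_fun_mult:
  assumes "f \<in> square_integrable_fun a"
  shows "(\<lambda>t. c * f t) \<in> square_integrable_fun a"
  using assms by (auto simp: square_integrable_fun_def norm_mult power_mult_distrib)

lemma scalar_mult_L2_class:
  assumes "f \<in> square_integrable_fun a"
  shows "scalar_mult (L2 a) c (L2_class a f) = L2_class a (\<lambda>t. c * f t)"
proof -
  have "L2_class a (\<lambda>t. c * g t) = L2_class a (\<lambda>t. c * f t)" if "g \<in> L2_class a f" for g
  proof -
    have g: "g \<in> square_integrable_fun a" and ae: "AE t in lebesgue_on {0..a}. f t = g t"
      using that by (auto simp: L2_class_def ae_eq_def)
    have "AE t in lebesgue_on {0..a}. c * g t = c * f t"
      using ae by eventually_elim simp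
    then show ?thesis
      by (simp add: L2_class_eq_iff square_integrable_fun_mult g assms)
  qed
  moreover have "f \<in> L2_class a f"
    using assms by (simp add: L2_class_def ae_eq_def)
  ultimately have "(\<Union>g\<in>L2_class a f. L2_class a (\<lambda>t. c * g t)) = L2_class a (\<lambda>t. c * f t)"
    by blast
  then show ?thesis
    by (simp add: L2_def)
qed

lemma inner_prod_L2_class:
  assumes f: "f \<in> square_integrable_fun a" and g: "g \<in> square_integrable_fun a"
  shows "inner_prod (L2 a) (L2_class a f) (L2_class a g)
           = (LINT t|lebesgue_on {0..a}. f t * cnj (g t))"
proof -
  have "(LINT t|lebesgue_on {0..a}. f' t * cnj (g' t))
          = (LINT t|lebesgue_on {0..a}. f t * cnj (g t))"
    if "f' \<in> L2_class a f" "g' \<in> L2_class a g" for f' g'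
  proof (rule integral_cong_AE)
    have [measurable]: "f' \<in> borel_measurable (lebesgue_on {0..a})"
      "g' \<in> borel_measurable (lebesgue_on {0..a})"
      "f \<in> borel_measurable (lebesgue_on {0..a})"
      "g \<in> borel_measurable (lebesgue_on {0..a})"
      using that f g by (auto simp: L2_class_def ae_eq_def square_integrable_fun_def)
    have [measurable]: "cnj \<in> borel_measurable borel"
      by (intro borel_measurable_continuous_onI continuous_intros)
    show "(\<lambda>t. f' t * cnj (g' t)) \<in> borel_measurable (lebesgue_on {0..a})"
      "(\<lambda>t. f t * cnj (g t)) \<in> borel_measurable (lebesgue_on {0..a})"
      by measurable
    have "AE t in lebesgue_on {0..a}. f t = f' t" "AE t in lebesgue_on {0..a}. g t = g' t"
      using that by (auto simp: L2_class_def ae_eq_def)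
    then show "AE t in lebesgue_on {0..a}. f' t * cnj (g' t) = f t * cnj (g t)"
      by eventually_elim simp
  qed
  moreover have "f \<in> L2_class a f" "g \<in> L2_class a g"
    using f g by (simp_all add: L2_class_def ae_eq_def)
  ultimately show ?thesis
    unfolding L2_def complex_space.simps by (intro the_equality) blast+
qed

lemma exponential_square_integrable: "exponential r \<in> square_integrable_fun a"
proof -
  have "cmod (exponential r t) = 1" for t
    by (simp add: exponential_def norm_exp_eq_Re)
  moreover have "exponential r \<in> borel_measurable (lebesgue_on {0..a})"
    unfolding exponential_def
    by (intro continuous_imp_measurable_on_sets_lebesgue continuous_intros) auto
  ultimately show ?thesis
    by (simp add: square_integrable_fun_def)
qed

lemma exponential_system_subset: "exponential_system a \<subseteq> elements (L2 a)"
  by (auto simp: exponential_system_def intro: L2_class_in_elements exponential_square_integrable)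

end

theory Submission
  imports Defs "HOL-Complex_Analysis.Cauchy_Integral_Formula"
begin

text \<open>Let \<open>F\<close> and \<open>H\<close> be the Fourier transforms of \<open>f\<close> and \<open>h\<close>; they are restrictions of entire functions.
  If \<open>\<Theta>\<close> is totally disconnected and \<open>H s \<noteq> 0\<close>, then \<open>F / H\<close> is continuous and \<open>\<Theta>\<close>-valued near \<open>s\<close>,
  hence equal to a constant \<open>\<theta>\<close> there. The transform of \<open>f - \<theta> h\<close> vanishes near \<open>s\<close>, so its Taylor
  coefficients at \<open>s\<close>, which are moments, vanish and Weierstrass approximation gives \<open>f = \<theta> h\<close>.

  Otherwise \<open>\<Theta>\<close> contains an arc, which contains \<open>\<theta> (1 - \<i> u) / (1 + \<i> u)\<close> for some \<open>\<theta>\<close> and all real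
  \<open>\<bar>u\<bar> \<le> e\<close>. Step functions \<open>f\<close> and \<open>h\<close> on three consecutive intervals of length \<open>a/3\<close> can be chosen so that
  \<open>F / H\<close> has this form with \<open>u = e sin (2 pi r a/3)\<close>, although \<open>f\<close> is no multiple of \<open>h\<close>.\<close>

section \<open>Moments on a compact interval and Weierstrass approximation\<close>

lemma integrable_mult_continuous_ivl:
  fixes w g :: "real \<Rightarrow> 'a :: {real_normed_field, euclidean_space}"
  assumes w: "integrable (lebesgue_on {a..b}) w" and g: "continuous_on {a..b} g"
  shows "integrable (lebesgue_on {a..b}) (\<lambda>t. w t * g t)"
proof -
  have "compact (g ` {a..b})"
    using g compact_continuous_image by blast
  then obtain B where B: "\<And>t. t \<in> {a..b} \<Longrightarrow> norm (g t) \<le> B"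
    by (meson compact_imp_bounded bounded_iff imageI)
  have [measurable]: "g \<in> borel_measurable (lebesgue_on {a..b})"
    using g by (intro continuous_imp_measurable_on_sets_lebesgue) auto
  have [measurable]: "w \<in> borel_measurable (lebesgue_on {a..b})"
    using w by auto
  show ?thesis
  proof (rule Bochner_Integration.integrable_bound)
    show "integrable (lebesgue_on {a..b}) (\<lambda>t. B * norm (w t))"
      using w by auto
    show "AE t in lebesgue_on {a..b}. norm (w t * g t) \<le> norm (B * norm (w t))"
    proof (rule AE_I2)
      fix t assume "t \<in> space (lebesgue_on {a..b})"
      then have "norm (g t) \<le> B" using B by simp
      then show "norm (w t * g t) \<le> norm (B * norm (w t))"
        by (simp add: norm_mult abs_mult mult.commute mult_right_mono)
    qed
  qed measurable
qed

text \<open>By linearity \<open>w\<close> integrates to 0 against every polynomial. A uniform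
  approximation of \<open>g\<close> by polynomials changes the integral by at most the uniform error
  times the L1 norm of \<open>w\<close>.\<close>

lemma moments_zero_imp_continuous_zero:
  fixes w :: "real \<Rightarrow> real"
  assumes w: "integrable (lebesgue_on {a..b}) w"
    and mom: "\<And>k. (LINT t|lebesgue_on {a..b}. w t * t ^ k) = 0"
    and g: "continuous_on {a..b} g"
  shows "(LINT t|lebesgue_on {a..b}. w t * g t) = 0"
proof -
  let ?M = "lebesgue_on {a..b}"
  let ?C = "LINT t|?M. norm (w t)"
  \<comment> \<open>The summand 0 fits the premise of \<open>field_le_epsilon\<close>.\<close>
  have "norm (LINT t|?M. w t * g t) \<le> 0 + e" if "e > 0" for e
  proof -
    \<comment> \<open>Chosen so that \<open>d * ?C\<close> is at most \<open>e\<close>; the added 1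
      keeps the denominator positive when \<open>w\<close> is null.\<close>
    define d where "d = e / (?C + 1)"
    have C: "?C \<ge> 0" by (rule integral_nonneg_AE) auto
    have d: "d > 0" unfolding d_def using C that by (intro divide_pos_pos) linarith+
    obtain p where p: "real_polynomial_function p" and pd: "\<And>t. t \<in> {a..b} \<Longrightarrow> \<bar>g t - p t\<bar> < d"
      using Stone_Weierstrass_real_polynomial_function[OF _ g d] by blast
    obtain c n where c: "p = (\<lambda>t. \<Sum>i\<le>n. c i * t ^ i)"
      using p real_polynomial_function_iff_sum by auto
    have int: "integrable ?M (\<lambda>t. w t * t ^ i)" for i
      by (intro integrable_mult_continuous_ivl w continuous_intros)
    have "(LINT t|?M. w t * p t) = (LINT t|?M. (\<Sum>i\<le>n. c i * (w t * t ^ i)))"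
      unfolding c by (simp add: sum_distrib_left mult.left_commute)
    also have "\<dots> = 0"
      by (subst Bochner_Integration.integral_sum) (use int mom in auto)
    finally have p0: "(LINT t|?M. w t * p t) = 0" .
    have pc: "continuous_on {a..b} p"
      unfolding c by (intro continuous_intros)
    have ig: "integrable ?M (\<lambda>t. w t * g t)" and ip: "integrable ?M (\<lambda>t. w t * p t)"
      by (intro integrable_mult_continuous_ivl w g pc)+
    have "(LINT t|?M. w t * g t) = (LINT t|?M. w t * g t - w t * p t)"
      using ig ip p0 by simp
    also have "norm \<dots> \<le> (LINT t|?M. norm (w t * g t - w t * p t))"
      by (rule integral_norm_bound)
    also have "\<dots> \<le> (LINT t|?M. d * norm (w t))"
    proof (rule integral_mono)
      show "integrable ?M (\<lambda>t. norm (w t * g t - w t * p t))"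
        using ig ip by auto
      show "integrable ?M (\<lambda>t. d * norm (w t))"
        using w by auto
      fix t assume "t \<in> space ?M"
      then have "\<bar>g t - p t\<bar> \<le> d" using pd[of t] by simp
      then show "norm (w t * g t - w t * p t) \<le> d * norm (w t)"
        using mult_right_mono[of "\<bar>g t - p t\<bar>" d "\<bar>w t\<bar>"]
        by (simp only: right_diff_distrib[symmetric]) (simp add: abs_mult mult.commute)
    qed
    also have "\<dots> = d * ?C" by simp
    also have "\<dots> \<le> e"
    proof -
      have "d * (?C + 1) = e"
        unfolding d_def by (rule nonzero_eq_divide_eq[THEN iffD1, OF _ refl]) (use C in linarith)
      then show ?thesis using d by (simp only: distrib_left mult_1_right)
    qed
    finally show ?thesis by simp
  qed
  then have "norm (LINT t|?M. w t * g t) \<le> 0"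
    by (rule field_le_epsilon)
  then show ?thesis by simp
qed

text \<open>Testing \<open>w\<close> against its own sign gives the integral of its absolute value.
  The sign is an almost everywhere limit of continuous functions, for which the previous lemma
  applies, so this integral is 0 by dominated convergence.\<close>

lemma moments_zero_imp_AE_zero:
  fixes w :: "real \<Rightarrow> real"
  assumes w: "integrable (lebesgue_on {a..b}) w"
    and mom: "\<And>k. (LINT t|lebesgue_on {a..b}. w t * t ^ k) = 0"
  shows "AE t in lebesgue_on {a..b}. w t = 0"
proof -
  let ?M = "lebesgue_on {a..b}"
  have wm [measurable]: "w \<in> borel_measurable ?M" using w by auto
  have "(\<lambda>t. sgn (w t)) \<in> borel_measurable ?M"
    by measurable
  then have "(\<lambda>t. sgn (w t)) measurable_on {a..b}"
    by (simp add: measurable_on_iff_borel_measurable)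
  then obtain N g where N: "negligible N" and gc: "\<And>n. continuous_on UNIV (g n)"
    and gl: "\<And>x. x \<notin> N \<Longrightarrow> (\<lambda>n. g n x) \<longlonglongrightarrow> (if x \<in> {a..b} then sgn (w x) else 0)"
    unfolding measurable_on_def by blast
  \<comment> \<open>Truncation to [-1, 1] leaves the limit unchanged, since a sign lies there, and
    makes the absolute value of \<open>w\<close> an integrable majorant.\<close>
  define h where "h n t = max (-1) (min 1 (g n t))" for n t
  have hc: "continuous_on {a..b} (h n)" for n
    unfolding h_def using gc by (intro continuous_intros) (auto intro: continuous_on_subset)
  have [measurable]: "h n \<in> borel_measurable ?M" for n
    using hc by (intro continuous_imp_measurable_on_sets_lebesgue) auto
  have "AE t in lebesgue. t \<notin> N"
    using N by (simp add: negligible_iff_null_sets AE_not_in)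
  then have AEN: "AE t in ?M. t \<notin> N"
    by (subst AE_restrict_space_iff) auto
  have "(\<lambda>n. LINT t|?M. w t * h n t) \<longlonglongrightarrow> (LINT t|?M. w t * sgn (w t))"
  proof (rule integral_dominated_convergence)
    show "integrable ?M (\<lambda>t. norm (w t))" using w by auto
    show "AE t in ?M. (\<lambda>n. w t * h n t) \<longlonglongrightarrow> w t * sgn (w t)"
      using AEN AE_space
    proof eventually_elim
      case (elim t)
      then have "(\<lambda>n. g n t) \<longlonglongrightarrow> sgn (w t)" using gl[of t] by simp
      then have "(\<lambda>n. h n t) \<longlonglongrightarrow> max (-1) (min 1 (sgn (w t)))"
        unfolding h_def by (intro tendsto_intros)
      moreover have "max (-1) (min 1 (sgn (w t))) = sgn (w t)"
        by (simp add: sgn_if)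
      ultimately show ?case by (intro tendsto_intros) simp
    qed
    show "AE t in ?M. norm (w t * h n t) \<le> norm (w t)" for n
    proof (rule AE_I2)
      fix t
      have "\<bar>h n t\<bar> \<le> 1" by (auto simp: h_def)
      then show "norm (w t * h n t) \<le> norm (w t)"
        by (simp add: abs_mult mult_left_le)
    qed
  qed measurable
  moreover have "(LINT t|?M. w t * h n t) = 0" for n
    by (rule moments_zero_imp_continuous_zero[OF w mom hc])
  ultimately have "(LINT t|?M. w t * sgn (w t)) = 0"
    by (simp add: LIMSEQ_const_iff)
  then have "(LINT t|?M. \<bar>w t\<bar>) = 0"
    by (simp add: abs_sgn)
  then show ?thesis
    using w by (subst (asm) integral_nonneg_eq_0_iff_AE) auto
qed

section \<open>Power series of Fourier transforms and local uniqueness\<close>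

lemma integral_exp_power_series:
  fixes v :: "real \<Rightarrow> complex"
  assumes v: "integrable (lebesgue_on {a..b}) v"
  shows "(\<lambda>k. (LINT t|lebesgue_on {a..b}. v t * of_real t ^ k) / fact k * z ^ k)
           sums (LINT t|lebesgue_on {a..b}. v t * exp (z * of_real t))"
proof -
  let ?M = "lebesgue_on {a..b}"
  \<comment> \<open>\<open>B\<close> bounds the absolute value of \<open>t\<close> on the interval.
    The terms are then dominated by those of the exponential series at \<open>cmod z * B\<close>,
    which justifies termwise integration.\<close>
  define B where "B = max \<bar>a\<bar> \<bar>b\<bar>"
  define f where "f k t = v t * ((z * of_real t) ^ k /\<^sub>R fact k)" for k t
  have int: "integrable ?M (f k)" for k
    unfolding f_def by (intro integrable_mult_continuous_ivl v continuous_intros)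
  have sumB: "summable (\<lambda>k. (cmod z * B) ^ k /\<^sub>R fact k)"
    by (rule summable_exp_generic)
  have fs: "(\<lambda>k. f k t) sums (v t * exp (z * of_real t))" for t
    unfolding f_def by (intro sums_mult exp_converges)
  have "(\<lambda>k. LINT t|?M. f k t) sums (LINT t|?M. (\<Sum>k. f k t))"
  proof (rule sums_integral)
    show "AE t in ?M. summable (\<lambda>k. norm (f k t))"
    proof (rule AE_I2)
      fix t :: real
      have "summable (\<lambda>k. norm (v t) * (norm (z * of_real t) ^ k /\<^sub>R fact k))"
        by (intro summable_mult summable_exp_generic)
      then show "summable (\<lambda>k. norm (f k t))"
        by (simp add: f_def norm_mult norm_power mult.left_commute)
    qed
    show "summable (\<lambda>k. LINT t|?M. norm (f k t))"
    proof (rule summable_comparison_test')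
      show "summable (\<lambda>k. ((cmod z * B) ^ k /\<^sub>R fact k) * (LINT t|?M. norm (v t)))"
        by (intro summable_mult2 sumB)
      fix k :: nat
      have "(LINT t|?M. norm (f k t)) \<le> (LINT t|?M. ((cmod z * B) ^ k /\<^sub>R fact k) * norm (v t))"
      proof (rule integral_mono)
        fix t assume "t \<in> space ?M"
        then have "\<bar>t\<bar> \<le> B" by (auto simp: B_def)
        then have "(cmod z * \<bar>t\<bar>) ^ k \<le> (cmod z * B) ^ k"
          by (intro power_mono mult_left_mono) auto
        then have "norm (v t) * ((cmod z * \<bar>t\<bar>) ^ k / fact k) \<le> norm (v t) * ((cmod z * B) ^ k / fact k)"
          by (intro mult_left_mono divide_right_mono) auto
        then show "norm (f k t) \<le> ((cmod z * B) ^ k /\<^sub>R fact k) * norm (v t)"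
          by (simp add: f_def norm_mult norm_power field_simps)
      qed (use int v in auto)
      then show "norm (LINT t|?M. norm (f k t)) \<le> ((cmod z * B) ^ k /\<^sub>R fact k) * (LINT t|?M. norm (v t))"
        by (simp add: integral_nonneg_AE)
    qed
  qed (rule int)
  moreover have "(LINT t|?M. f k t) = (LINT t|?M. v t * of_real t ^ k) / fact k * z ^ k" for k
  proof -
    have "(LINT t|?M. f k t) = (LINT t|?M. (v t * of_real t ^ k) * (z ^ k / fact k))"
      by (simp add: f_def power_mult_distrib scaleR_conv_of_real field_simps)
    then show ?thesis by simp
  qed
  moreover have "(\<Sum>k. f k t) = v t * exp (z * of_real t)" for t
    using fs sums_unique by metis
  ultimately show ?thesis by simp
qed

lemma Re_mult_real: "Re (z * of_real x) = Re z * x"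
  and Im_mult_real: "Im (z * of_real x) = Im z * x"
  by simp_all

text \<open>Zeros of a nontrivial power series are isolated. \<open>powser_0_nonzero\<close> asks
  for a nonzero coefficient of positive index, so the constant term is treated separately by
  evaluation at 0.\<close>

lemma real_powser_eventually_zero:
  fixes c :: "nat \<Rightarrow> real"
  assumes r: "0 < r" and c: "\<And>x. norm x < r \<Longrightarrow> (\<lambda>k. c k * x ^ k) sums 0"
  shows "c k = 0"
proof (rule ccontr)
  assume nz: "c k \<noteq> 0"
  show False
  proof (cases "k = 0")
    case True
    then show ?thesis using c[of 0] r nz by simp
  next
    case False
    obtain s where s: "0 < s" "\<And>z::real. z \<in> cball 0 s - {0} \<Longrightarrow> (\<lambda>_. 0 :: real) z \<noteq> 0"
      by (rule powser_0_nonzero[of r 0 c "\<lambda>_. 0" k]) (use r c nz False in auto)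
    then show ?thesis using s(2)[of s] by simp
  qed
qed

lemma fourier_zero_near_imp_AE_zero:
  fixes u :: "real \<Rightarrow> complex"
  assumes u: "integrable (lebesgue_on {a..b}) u" and d: "d > 0"
    and zero: "\<And>r. \<bar>r - s\<bar> < d \<Longrightarrow> (LINT t|lebesgue_on {a..b}. u t * cnj (exponential r t)) = 0"
  shows "AE t in lebesgue_on {a..b}. u t = 0"
proof -
  let ?M = "lebesgue_on {a..b}"
  \<comment> \<open>Multiplication by a unimodular exponential moves the centre \<open>s\<close> to
    the origin and preserves the zero set of \<open>u\<close>.\<close>
  define v where "v t = u t * cnj (exponential s t)" for t
  have v: "integrable ?M v"
    unfolding v_def exponential_def
    by (intro integrable_mult_continuous_ivl u continuous_intros)
  define z :: complex where "z = - 2 * of_real pi * \<i>"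
  have z: "z \<noteq> 0" by (simp add: z_def)
  have shift: "u t * cnj (exponential (s + x) t) = v t * exp (z * of_real x * of_real t)" for x t
    by (simp add: v_def z_def exponential_def exp_cnj exp_add[symmetric] algebra_simps)
  define m where "m k = (LINT t|?M. v t * of_real t ^ k)" for k
  have ser: "(\<lambda>k. (m k / fact k * z ^ k) * of_real x ^ k) sums 0" if "\<bar>x\<bar> < d" for x :: real
  proof -
    have "(LINT t|?M. v t * exp (z * of_real x * of_real t)) = 0"
      using zero[of "s + x"] that shift by simp
    then show ?thesis
      using integral_exp_power_series[OF v, of "z * of_real x"]
      by (simp add: m_def power_mult_distrib mult.assoc)
  qed
  \<comment> \<open>For real \<open>x\<close> the real and imaginary parts of the series are real
    power series in \<open>x\<close> that vanish near 0.\<close>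
  have c0: "m k / fact k * z ^ k = 0" for k
  proof (rule complex_eqI)
    show "Re (m k / fact k * z ^ k) = Re 0"
      using real_powser_eventually_zero[OF d, of "\<lambda>k. Re (m k / fact k * z ^ k)" k]
        sums_Re[OF ser] by (simp only: of_real_power[symmetric] Re_mult_real) simp
    show "Im (m k / fact k * z ^ k) = Im 0"
      using real_powser_eventually_zero[OF d, of "\<lambda>k. Im (m k / fact k * z ^ k)" k]
        sums_Im[OF ser] by (simp only: of_real_power[symmetric] Im_mult_real) simp
  qed
  have m0: "m k = 0" for k
    using c0[of k] z by simp
  have int: "integrable ?M (\<lambda>t. v t * of_real t ^ k)" for k
    by (intro integrable_mult_continuous_ivl v continuous_intros)
  \<comment> \<open>The moment lemma concerns real weights, so the two parts of \<open>v\<close> are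
    handled separately.\<close>
  have "AE t in ?M. Re (v t) = 0"
  proof (rule moments_zero_imp_AE_zero)
    show "(LINT t|?M. Re (v t) * t ^ k) = 0" for k
      using integral_Re[OF int[of k]] m0[of k] by (simp add: m_def flip: of_real_power)
  qed (use v in auto)
  moreover have "AE t in ?M. Im (v t) = 0"
  proof (rule moments_zero_imp_AE_zero)
    show "(LINT t|?M. Im (v t) * t ^ k) = 0" for k
      using integral_Im[OF int[of k]] m0[of k] by (simp add: m_def flip: of_real_power)
  qed (use v in auto)
  ultimately show ?thesis
  proof eventually_elim
    case (elim t)
    then have "v t = 0" by (simp add: complex_eqI)
    then show ?case by (simp add: v_def exponential_def)
  qed
qed

section \<open>Arcs in connected subsets of the circle\<close>

lemma cmod_cayley: "cmod ((1 - \<i> * of_real u) / (1 + \<i> * of_real u)) = 1"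
proof -
  have "cmod (1 - \<i> * of_real u) = cmod (cnj (1 - \<i> * of_real u))"
    by (rule complex_mod_cnj[symmetric])
  also have "\<dots> = cmod (1 + \<i> * of_real u)" by simp
  finally have "cmod (1 - \<i> * of_real u) = cmod (1 + \<i> * of_real u)" .
  moreover have "1 + \<i> * of_real u \<noteq> 0" by (simp add: complex_eq_iff)
  ultimately show ?thesis by (simp add: norm_divide)
qed

text \<open>If \<open>S\<close> misses a point of the circle, a Cayley transform carries it to a
  real interval with more than one point, and any interior point of that interval yields an arc
  inside \<open>S\<close>. The parametrisation is the form in which quotients of transforms arise in
  the counterexample.\<close>

lemma connected_circle_subset_contains_arc:
  fixes S :: "complex set"
  assumes S: "connected S" "S \<subseteq> sphere 0 1" and pq: "p \<in> S" "q \<in> S" "p \<noteq> q"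
  obtains \<theta> e where "\<theta> \<in> sphere 0 1" "e > 0"
    "\<And>u::real. \<bar>u\<bar> \<le> e \<Longrightarrow> \<theta> * ((1 - \<i> * of_real u) / (1 + \<i> * of_real u)) \<in> S"
proof (cases "S = sphere 0 1")
  case True
  then show ?thesis
    using that[of p 1] pq(1) by (simp add: norm_mult cmod_cayley del: times_divide_eq_right)
next
  case False
  then obtain z0 where z0: "cmod z0 = 1" "z0 \<notin> S" using S(2)
    by (metis mem_sphere_0 subsetI subset_antisym)
  \<comment> \<open>A Cayley transform maps the circle without \<open>z0\<close> homeomorphically to the real line.\<close>
  define g where "g z = Re (\<i> * (z0 + z) / (z0 - z))" for z
  \<comment> \<open>On the circle conjugation is inversion, and inverting both \<open>z\<close> and
    \<open>z0\<close> leaves the fraction unchanged, so it is real and \<open>Re\<close> loses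
    nothing.\<close>
  have g_eq: "of_real (g z) = \<i> * (z0 + z) / (z0 - z)" if "cmod z = 1" "z \<noteq> z0" for z
  proof -
    have "z * cnj z = 1" "z0 * cnj z0 = 1"
      using that z0 by (simp_all add: complex_norm_square[symmetric])
    moreover from this have nz: "z \<noteq> 0" "z0 \<noteq> 0" by auto
    ultimately have c: "cnj z = 1 / z" "cnj z0 = 1 / z0"
      by (simp_all add: nonzero_eq_divide_eq mult.commute)
    have "cnj (\<i> * (z0 + z) / (z0 - z)) = \<i> * (z0 + z) / (z0 - z)"
      using nz that(2) by (simp add: c divide_simps) (simp add: algebra_simps)
    then have "\<i> * (z0 + z) / (z0 - z) \<in> \<real>"
      by (simp add: Reals_cnj_iff)
    then show ?thesis unfolding g_def by (rule of_real_Re)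
  qed
  have g_inj: "z = z'" if "cmod z = 1" "z \<noteq> z0" "cmod z' = 1" "z' \<noteq> z0" "g z = g z'" for z z'
  proof -
    have "\<i> * (z0 + z) / (z0 - z) = \<i> * (z0 + z') / (z0 - z')"
      using g_eq[of z] g_eq[of z'] that by simp
    then have "(z0 + z) * (z0 - z') = (z0 + z') * (z0 - z)"
      using that by (simp add: frac_eq_eq)
    then have "2 * z0 * z = 2 * z0 * z'" by (simp add: algebra_simps)
    then show ?thesis using z0(1) by auto
  qed
  have Sg: "cmod z = 1 \<and> z \<noteq> z0" if "z \<in> S" for z
    using that S(2) z0 by auto
  have gcont: "continuous_on (- {z0}) g"
    unfolding g_def by (intro continuous_intros) auto
  then have "connected (g ` S)"
    using S(1) Sg by (intro connected_continuous_image) (auto intro: continuous_on_subset)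
  have "g p \<noteq> g q" using g_inj[of p q] Sg pq by auto
  then obtain p' q' where pq': "p' \<in> S" "q' \<in> S" "g p' < g q'"
    using pq by (meson linorder_neqE)
  have sub: "{g p'..g q'} \<subseteq> g ` S"
    by (rule connected_contains_Icc) (use \<open>connected (g ` S)\<close> pq' in auto)
  \<comment> \<open>The midpoint has room on both sides, so the strict bounds on
    \<open>g (k u)\<close> persist for small \<open>u\<close>; injectivity of \<open>g\<close> then
    puts \<open>k u\<close> itself in \<open>S\<close>.\<close>
  obtain \<theta> where \<theta>: "\<theta> \<in> S" "g \<theta> = (g p' + g q') / 2"
  proof -
    have "(g p' + g q') / 2 \<in> g ` S" using sub pq'(3) by auto
    then show ?thesis using that by force
  qed
  define k where "k u = \<theta> * ((1 - \<i> * of_real u) / (1 + \<i> * of_real u))" for u :: real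
  have kn: "cmod (k u) = 1" for u
    using Sg[OF \<theta>(1)] by (simp add: k_def norm_mult cmod_cayley del: times_divide_eq_right)
  have "isCont k 0"
    unfolding k_def by (intro continuous_intros) auto
  then have kl: "(k \<longlongrightarrow> \<theta>) (nhds 0)"
    by (simp add: isCont_def tendsto_nhds_iff k_def)
  have "isCont g \<theta>"
    using gcont Sg[OF \<theta>(1)] by (simp add: continuous_on_eq_continuous_at open_Compl)
  then have gl: "((\<lambda>u. g (k u)) \<longlongrightarrow> g \<theta>) (nhds 0)"
    using kl by (rule isCont_tendsto_compose)
  have "\<forall>\<^sub>F u in nhds 0. k u \<noteq> z0"
    using kl Sg[OF \<theta>(1)] by (intro tendsto_imp_eventually_ne) auto
  moreover have "\<forall>\<^sub>F u in nhds 0. g p' < g (k u)" "\<forall>\<^sub>F u in nhds 0. g (k u) < g q'"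
    using order_tendstoD[OF gl] \<theta>(2) pq'(3) by auto
  ultimately have "\<forall>\<^sub>F u in nhds 0. k u \<in> S"
  proof eventually_elim
    case (elim u)
    then have "g (k u) \<in> g ` S" using sub by auto
    then obtain s where "s \<in> S" "g (k u) = g s" by auto
    then have "k u = s" using g_inj[of "k u" s] kn[of u] Sg elim by auto
    with \<open>s \<in> S\<close> show ?case by simp
  qed
  then obtain d where "d > 0" "\<And>u. dist u 0 < d \<Longrightarrow> k u \<in> S"
    unfolding eventually_nhds_metric by blast
  \<comment> \<open>Halving \<open>d\<close> turns the open condition on \<open>u\<close> into the
    closed one; the bound \<open>e\<close> is attained later when the sine is 1 or -1.\<close>
  then show ?thesis
    using that[of \<theta> "d / 2"] Sg[OF \<theta>(1)] by (auto simp: k_def)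
qed

section \<open>Phase retrieval restated for functions instead of classes\<close>

lemma square_integrable_imp_integrable:
  assumes "f \<in> square_integrable_fun a"
  shows "integrable (lebesgue_on {0..a}) f"
proof (rule Bochner_Integration.integrable_bound)
  show "integrable (lebesgue_on {0..a}) (\<lambda>t. 1 + (cmod (f t))\<^sup>2)"
    using assms by (auto simp: square_integrable_fun_def)
  show "AE t in lebesgue_on {0..a}. norm (f t) \<le> norm (1 + (cmod (f t))\<^sup>2)"
  proof (rule AE_I2)
    fix t
    have "0 \<le> (cmod (f t) - 1)\<^sup>2" by simp
    then have "2 * cmod (f t) \<le> 1 + (cmod (f t))\<^sup>2"
      by (simp add: power2_eq_square algebra_simps)
    then show "norm (f t) \<le> norm (1 + (cmod (f t))\<^sup>2)"
      using norm_ge_zero[of "f t"] unfolding real_norm_def by linarith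
  qed
qed (use assms in \<open>auto simp: square_integrable_fun_def\<close>)

lemma bounded_imp_square_integrable:
  assumes f: "f \<in> borel_measurable (lebesgue_on {0..a})" and B: "\<And>t. cmod (f t) \<le> B"
  shows "f \<in> square_integrable_fun a"
proof -
  have "integrable (lebesgue_on {0..a}) (\<lambda>t. (cmod (f t))\<^sup>2)"
  proof (rule Bochner_Integration.integrable_bound)
    show "integrable (lebesgue_on {0..a}) (\<lambda>t. B\<^sup>2)" by auto
    show "AE t in lebesgue_on {0..a}. norm ((cmod (f t))\<^sup>2) \<le> norm (B\<^sup>2)"
      using B by (auto intro!: AE_I2 power_mono)
  qed (use f in measurable)
  with f show ?thesis by (simp add: square_integrable_fun_def)
qed

lemma does_PR_L2_iff:
  "does_PR \<Theta> (L2 a) (exponential_system a) \<longleftrightarrow>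
    (\<forall>f\<in>square_integrable_fun a. \<forall>h\<in>square_integrable_fun a.
       (\<forall>r. \<exists>\<theta>\<in>\<Theta>. (LINT t|lebesgue_on {0..a}. f t * cnj (exponential r t))
                   = \<theta> * (LINT t|lebesgue_on {0..a}. h t * cnj (exponential r t)))
       \<longrightarrow> (\<exists>\<theta>\<in>\<Theta>. AE t in lebesgue_on {0..a}. f t = \<theta> * h t))"
proof -
  have *: "elements (L2 a) = L2_class a ` square_integrable_fun a"
    using L2_class_in_elements L2_elementE by blast
  show ?thesis
    unfolding does_PR_def * exponential_system_def
    by (simp add: inner_prod_L2_class exponential_square_integrable scalar_mult_L2_class
        L2_class_eq_iff square_integrable_fun_mult)
qed

section \<open>Total disconnectedness implies phase retrieval\<close>

lemma isCont_fourier: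
  assumes v: "integrable (lebesgue_on {a..b}) v"
  shows "isCont (\<lambda>r. LINT t|lebesgue_on {a..b}. v t * cnj (exponential r t)) s"
proof -
  let ?M = "lebesgue_on {a..b}"
  \<comment> \<open>With this \<open>z\<close>, \<open>exp (z * r * t)\<close> is the conjugate
    exponential, so the transform is an everywhere convergent power series evaluated on the
    imaginary axis.\<close>
  define z :: complex where "z = - 2 * of_real pi * \<i>"
  define c where "c k = (LINT t|?M. v t * of_real t ^ k) / fact k" for k
  have ser: "(\<lambda>k. c k * w ^ k) sums (LINT t|?M. v t * exp (w * of_real t))" for w
    unfolding c_def by (rule integral_exp_power_series[OF v])
  have cont: "isCont (\<lambda>w. \<Sum>k. c k * w ^ k) w" for w
    by (rule isCont_powser_converges_everywhere) (use ser in \<open>blast intro: sums_summable\<close>)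
  have "isCont (\<lambda>r. z * of_real r) s"
    by (intro continuous_intros)
  from isCont_o2[OF this cont] have "isCont (\<lambda>r. \<Sum>k. c k * (z * of_real r) ^ k) s" .
  moreover have "(\<Sum>k. c k * (z * of_real r) ^ k) = (LINT t|?M. v t * cnj (exponential r t))" for r
    using sums_unique[OF ser[of "z * of_real r"]]
    by (simp add: exponential_def exp_cnj z_def mult.assoc)
  ultimately show ?thesis by simp
qed

lemma totally_disconnected_imp_PR:
  assumes td: "totally_disconnected_space (top_of_set \<Theta>)" and ne: "\<Theta> \<noteq> {}"
  shows "does_PR \<Theta> (L2 a) (exponential_system a)"
  unfolding does_PR_L2_iff
proof (intro ballI impI)
  fix f h assume f: "f \<in> square_integrable_fun a" and h: "h \<in> square_integrable_fun a"
  let ?M = "lebesgue_on {0..a}"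
  define F where "F r = (LINT t|?M. f t * cnj (exponential r t))" for r
  define H where "H r = (LINT t|?M. h t * cnj (exponential r t))" for r
  assume "\<forall>r. \<exists>\<theta>\<in>\<Theta>. (LINT t|?M. f t * cnj (exponential r t)) = \<theta> * (LINT t|?M. h t * cnj (exponential r t))"
  then have FH: "\<exists>\<theta>\<in>\<Theta>. F r = \<theta> * H r" for r
    by (simp add: F_def H_def)
  note fi = square_integrable_imp_integrable[OF f] and hi = square_integrable_imp_integrable[OF h]
  \<comment> \<open>Proportionality of the transforms on one open interval, however short, already
    gives proportionality of the functions.\<close>
  have eqI: "AE t in ?M. f t = \<theta> * h t" if "d > 0" and eq: "\<And>r. \<bar>r - s\<bar> < d \<Longrightarrow> F r = \<theta> * H r" for s d \<theta>
  proof -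
    have "AE t in ?M. f t - \<theta> * h t = 0"
    proof (rule fourier_zero_near_imp_AE_zero)
      fix r assume r: "\<bar>r - s\<bar> < d"
      have "integrable ?M (\<lambda>t. f t * cnj (exponential r t))" "integrable ?M (\<lambda>t. h t * cnj (exponential r t))"
        unfolding exponential_def by (intro integrable_mult_continuous_ivl fi hi continuous_intros)+
      then have "(LINT t|?M. f t * cnj (exponential r t) - \<theta> * (h t * cnj (exponential r t))) = F r - \<theta> * H r"
        by (simp add: F_def H_def)
      then show "(LINT t|?M. (f t - \<theta> * h t) * cnj (exponential r t)) = 0"
        using eq[OF r] by (simp add: algebra_simps)
    qed (use fi hi that in auto)
    then show ?thesis by simp
  qed
  show "\<exists>\<theta>\<in>\<Theta>. AE t in ?M. f t = \<theta> * h t"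
  proof (cases "\<exists>s. H s \<noteq> 0")
    \<comment> \<open>Both transforms vanish identically here, so any element of the nonempty
      \<open>\<Theta>\<close> serves.\<close>
    case False
    obtain \<theta> where "\<theta> \<in> \<Theta>" using ne by blast
    moreover have "F r = \<theta> * H r" for r
      using FH[of r] False by auto
    ultimately show ?thesis using eqI[of 1 0 \<theta>] by auto
  next
    case True
    then obtain s where s: "H s \<noteq> 0" by blast
    have Hc: "isCont H r" and Fc: "isCont F r" for r
      unfolding F_def H_def by (intro isCont_fourier fi hi)+
    obtain d where d: "d > 0" "\<And>r. dist r s < d \<Longrightarrow> H r \<noteq> 0"
      using continuous_at_avoid[OF Hc s] by (metis dist_commute)
    let ?I = "ball s d"
    have I: "H r \<noteq> 0" if "r \<in> ?I" for r
      using d(2) that by (simp add: dist_commute)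
    have "continuous_on ?I (\<lambda>r. F r / H r)"
      using I Fc Hc by (intro continuous_on_divide continuous_at_imp_continuous_on ballI)
    then have "connected ((\<lambda>r. F r / H r) ` ?I)"
      by (intro connected_continuous_image) auto
    moreover have sub: "(\<lambda>r. F r / H r) ` ?I \<subseteq> \<Theta>"
    proof (rule image_subsetI)
      fix r assume "r \<in> ?I"
      then show "F r / H r \<in> \<Theta>" using FH[of r] I[of r] by auto
    qed
    ultimately have "connectedin (top_of_set \<Theta>) ((\<lambda>r. F r / H r) ` ?I)"
      by (simp add: connectedin_subtopology)
    then obtain \<theta> where \<theta>: "(\<lambda>r. F r / H r) ` ?I \<subseteq> {\<theta>}"
      using td unfolding totally_disconnected_space_def by blast
    have "\<theta> \<in> \<Theta>" using \<theta> sub d(1) by (metis (no_types, lifting) centre_in_ball image_subset_iff singletonD)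
    moreover have "F r = \<theta> * H r" if "\<bar>r - s\<bar> < d" for r
    proof -
      have r: "r \<in> ?I" using that by (simp add: dist_real_def abs_minus_commute)
      then have "F r / H r = \<theta>" using \<theta> by blast
      then show ?thesis using I[OF r] by auto
    qed
    ultimately show ?thesis using eqI[OF d(1)] by blast
  qed
qed

section \<open>Step functions that defeat phase retrieval on an arc\<close>

lemma fourier_translated_indicator:
  assumes b: "0 \<le> b"
  shows "(LINT t|lebesgue. of_real (indicator {c..<c + b} t) * cnj (exponential r t))
       = cnj (exponential r c) * (LINT t|lebesgue. of_real (indicator {0..<b} t) * cnj (exponential r t))"
proof -
  have "(LINT t|lebesgue. of_real (indicator {c..<c + b} t) * cnj (exponential r t))
      = (LINT t|lebesgue. of_real (indicator {c..<c + b} (c + 1 * t)) * cnj (exponential r (c + 1 * t)))"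
    by (subst lebesgue_integral_real_affine[of 1 _ c]) simp_all
  also have "\<dots> = (LINT t|lebesgue. cnj (exponential r c) * (of_real (indicator {0..<b} t) * cnj (exponential r t)))"
    by (intro Bochner_Integration.integral_cong)
       (auto simp: indicator_def exponential_def exp_cnj exp_add[symmetric] algebra_simps)
  finally show ?thesis by simp
qed

text \<open>An interval of positive length is not null. This lets an almost everywhere identity
  between step functions be evaluated on each step.\<close>

lemma exists_AE_point:
  fixes c d :: real
  assumes P: "AE t in lebesgue_on {a..b}. P t" and cd: "c < d" "{c..<d} \<subseteq> {a..b}"
  obtains t where "t \<in> {c..<d}" "P t"
proof -
  have "AE t in lebesgue. t \<in> {a..b} \<longrightarrow> P t"
    using P by (subst (asm) AE_restrict_space_iff) auto
  then obtain N where N: "{t. \<not> (t \<in> {a..b} \<longrightarrow> P t)} \<subseteq> N" "emeasure lebesgue N = 0" "N \<in> sets lebesgue"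
    by (auto elim!: AE_E)
  have "\<not> {c..<d} \<subseteq> N"
  proof
    assume "{c..<d} \<subseteq> N"
    then have "emeasure lebesgue {c..<d} \<le> emeasure lebesgue N"
      using N by (intro emeasure_mono)
    then show False using N(2) cd(1) by simp
  qed
  then show ?thesis using N(1) cd(2) that by blast
qed

lemma PR_imp_totally_disconnected:
  assumes a: "a > 0" and \<Theta>: "\<Theta> \<subseteq> sphere 0 1" and PR: "does_PR \<Theta> (L2 a) (exponential_system a)"
  shows "totally_disconnected_space (top_of_set \<Theta>)"
proof (rule ccontr)
  assume "\<not> ?thesis"
  then obtain S where "connectedin (top_of_set \<Theta>) S" and nS: "\<And>x. \<not> S \<subseteq> {x}"
    unfolding totally_disconnected_space_def by blast
  then have S: "connected S" "S \<subseteq> \<Theta>" by (simp_all add: connectedin_subtopology)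
  obtain p where p: "p \<in> S" using nS by blast
  obtain q where q: "q \<in> S" "p \<noteq> q" using nS[of p] by blast
  obtain \<theta> e where \<theta>: "\<theta> \<in> sphere 0 1" and e: "e > 0"
    and arc: "\<And>u::real. \<bar>u\<bar> \<le> e \<Longrightarrow> \<theta> * ((1 - \<i> * of_real u) / (1 + \<i> * of_real u)) \<in> \<Theta>"
    using connected_circle_subset_contains_arc[OF S(1) _ p q] S(2) \<Theta> by (metis subset_eq)
  let ?M = "lebesgue_on {0..a}"
  define b where "b = a / 3"
  have b: "b > 0" "a = 3 * b" using a by (simp_all add: b_def)
  define \<psi> :: "nat \<Rightarrow> real \<Rightarrow> complex" where "\<psi> j t = of_real (indicator {j * b..<j * b + b} t)" for j t
  \<comment> \<open>On the three thirds \<open>h\<close> takes the values \<open>e / 2\<close>, 1,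
    \<open>- e / 2\<close>, and \<open>f\<close> is \<open>\<theta>\<close> times the same pattern
    with \<open>e\<close> negated. Negating \<open>e\<close> negates \<open>u\<close>, which turns
    the factor \<open>1 + \<i> * u\<close> of one transform into \<open>1 - \<i> * u\<close> in the
    other.\<close>
  define h where "h t = \<psi> 1 t + of_real (e / 2) * (\<psi> 0 t - \<psi> 2 t)" for t
  define f where "f t = \<theta> * (\<psi> 1 t - of_real (e / 2) * (\<psi> 0 t - \<psi> 2 t))" for t
  have \<psi>m [measurable]: "\<psi> j \<in> borel_measurable ?M" for j
    unfolding \<psi>_def by (rule measurable_restrict_space1, rule measurable_completion) measurable
  have \<psi>b: "cmod (\<psi> j t) \<le> 1" for j t
    by (simp add: \<psi>_def indicator_def)
  have \<psi>i: "integrable ?M (\<psi> j)" for j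
    by (intro square_integrable_imp_integrable bounded_imp_square_integrable[OF \<psi>m \<psi>b])
  \<comment> \<open>Used with \<open>s = e / 2\<close> for \<open>h\<close> and with
    \<open>s = - (e / 2)\<close> for \<open>f\<close>.\<close>
  have tri: "cmod (\<psi> 1 t + of_real s * (\<psi> 0 t - \<psi> 2 t)) \<le> 1 + \<bar>s\<bar> * 2" for s t
  proof -
    have "cmod (\<psi> 0 t - \<psi> 2 t) \<le> 2"
      using norm_triangle_ineq4[of "\<psi> 0 t" "\<psi> 2 t"] \<psi>b[of 0 t] \<psi>b[of 2 t] by linarith
    then have "cmod (of_real s * (\<psi> 0 t - \<psi> 2 t)) \<le> \<bar>s\<bar> * 2"
      by (simp add: norm_mult mult_left_mono)
    then show ?thesis
      using norm_triangle_ineq[of "\<psi> 1 t" "of_real s * (\<psi> 0 t - \<psi> 2 t)"] \<psi>b[of 1 t] by linarith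
  qed
  have hsq: "h \<in> square_integrable_fun a"
  proof (rule bounded_imp_square_integrable)
    show "cmod (h t) \<le> 1 + \<bar>e / 2\<bar> * 2" for t unfolding h_def by (rule tri)
  qed (unfold h_def, measurable)
  have "(\<lambda>t. \<psi> 1 t - of_real (e / 2) * (\<psi> 0 t - \<psi> 2 t)) \<in> square_integrable_fun a"
  proof (rule bounded_imp_square_integrable)
    show "cmod (\<psi> 1 t - of_real (e / 2) * (\<psi> 0 t - \<psi> 2 t)) \<le> 1 + \<bar>- (e / 2)\<bar> * 2" for t
      using tri[of t "- (e / 2)"] by simp
  qed measurable
  then have fsq: "f \<in> square_integrable_fun a"
    unfolding f_def by (rule square_integrable_fun_mult)
  \<comment> \<open>With \<open>\<zeta>\<close> the conjugate exponential at \<open>b\<close>, the transforms of \<open>h\<close> and \<open>f\<close> are those of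
    \<open>\<psi> 0\<close> times \<open>\<zeta> + e/2 (1 - \<zeta>\<^sup>2)\<close> and \<open>\<theta> (\<zeta> - e/2 (1 - \<zeta>\<^sup>2))\<close>, and \<open>(1 - \<zeta>\<^sup>2)/2 = \<i> \<zeta> sin (2 pi r b)\<close>.\<close>
  have "\<exists>\<theta>'\<in>\<Theta>. (LINT t|?M. f t * cnj (exponential r t)) = \<theta>' * (LINT t|?M. h t * cnj (exponential r t))" for r
  proof -
    define P where "P j = (LINT t|?M. \<psi> j t * cnj (exponential r t))" for j
    define \<zeta> where "\<zeta> = cnj (exponential r b)"
    define u where "u = e * sin (2 * pi * r * b)"
    have int: "integrable ?M (\<lambda>t. \<psi> j t * cnj (exponential r t))" for j
      unfolding exponential_def by (intro integrable_mult_continuous_ivl \<psi>i continuous_intros)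
    \<comment> \<open>For \<open>j\<close> at most 2 the step lies inside [0, a]. Passing to the
      whole line makes the translation formula applicable.\<close>
    have PL: "P j = (LINT t|lebesgue. of_real (indicator {j * b..<j * b + b} t) * cnj (exponential r t))"
      if "j \<le> 2" for j
    proof -
      have "0 \<le> real j * b" "real j * b \<le> 2 * b" using that b(1) by simp_all
      then have "t \<in> {0..a}" if "t \<in> {j * b..<j * b + b}" for t
        using that b unfolding atLeastLessThan_iff atLeastAtMost_iff by linarith
      then have "indicator {0..a} t *\<^sub>R \<psi> j t = \<psi> j t" for t
        by (auto simp: \<psi>_def indicator_def)
      then have "indicator {0..a} t *\<^sub>R (\<psi> j t * cnj (exponential r t)) = \<psi> j t * cnj (exponential r t)" for t
        by (metis mult_scaleR_left)
      then show ?thesis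
        unfolding P_def by (subst integral_restrict_space) (simp_all add: \<psi>_def)
    qed
    have Pj: "P j = cnj (exponential r (j * b)) * P 0" if "j \<le> 2" for j
      using PL[OF that] PL[of 0] fourier_translated_indicator[of b "j * b" r] b(1) by simp
    have P1: "P 1 = \<zeta> * P 0" using Pj[of 1] by (simp add: \<zeta>_def)
    have P2: "P 2 = \<zeta>\<^sup>2 * P 0"
      using Pj[of 2] by (simp add: \<zeta>_def exponential_def exp_double[symmetric] algebra_simps flip: complex_cnj_power)
    have \<zeta>cis: "\<zeta> = cis (- (2 * pi * r * b))"
      by (simp add: \<zeta>_def exponential_def cis_conv_exp exp_cnj algebra_simps)
    have eu: "of_real e * (1 - \<zeta>\<^sup>2) = 2 * \<i> * of_real u * \<zeta>"
    proof -
      have "\<zeta>\<^sup>2 + 2 * \<i> * of_real (sin (2 * pi * r * b)) * \<zeta> = \<zeta> * (\<zeta> + 2 * \<i> * of_real (sin (2 * pi * r * b)))"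
        by (simp add: power2_eq_square algebra_simps)
      also have "\<zeta> + 2 * \<i> * of_real (sin (2 * pi * r * b)) = cis (2 * pi * r * b)"
        by (simp add: \<zeta>cis complex_eq_iff)
      also have "\<zeta> * cis (2 * pi * r * b) = 1"
        by (simp add: \<zeta>cis cis_mult)
      finally have "1 - \<zeta>\<^sup>2 = 2 * \<i> * of_real (sin (2 * pi * r * b)) * \<zeta>"
        by (simp add: algebra_simps)
      then show ?thesis by (simp add: u_def)
    qed
    have "(LINT t|?M. h t * cnj (exponential r t))
        = (LINT t|?M. \<psi> 1 t * cnj (exponential r t) + of_real (e / 2) *
             (\<psi> 0 t * cnj (exponential r t) - \<psi> 2 t * cnj (exponential r t)))"
      by (simp add: h_def algebra_simps)
    also have "\<dots> = P 1 + of_real (e / 2) * (P 0 - P 2)"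
      using int by (simp add: P_def)
    also have "\<dots> = P 0 * \<zeta> + (of_real e * (1 - \<zeta>\<^sup>2)) * P 0 / 2"
      unfolding P1 P2 by (simp add: field_simps)
    also have "\<dots> = P 0 * \<zeta> * (1 + \<i> * of_real u)"
      unfolding eu by (simp add: field_simps)
    finally have H: "(LINT t|?M. h t * cnj (exponential r t)) = P 0 * \<zeta> * (1 + \<i> * of_real u)" .
    have "(LINT t|?M. f t * cnj (exponential r t))
        = (LINT t|?M. \<theta> * (\<psi> 1 t * cnj (exponential r t) - of_real (e / 2) *
             (\<psi> 0 t * cnj (exponential r t) - \<psi> 2 t * cnj (exponential r t))))"
      by (simp add: f_def algebra_simps)
    also have "\<dots> = \<theta> * (P 1 - of_real (e / 2) * (P 0 - P 2))"
      using int by (simp add: P_def)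
    also have "\<dots> = \<theta> * (P 0 * \<zeta> - (of_real e * (1 - \<zeta>\<^sup>2)) * P 0 / 2)"
      unfolding P1 P2 by (simp add: field_simps)
    also have "\<dots> = \<theta> * (P 0 * \<zeta> * (1 - \<i> * of_real u))"
      unfolding eu by (simp add: field_simps)
    finally have F: "(LINT t|?M. f t * cnj (exponential r t)) = \<theta> * (P 0 * \<zeta> * (1 - \<i> * of_real u))" .
    have "\<bar>u\<bar> \<le> e"
      using e by (simp add: u_def abs_mult mult_left_le)
    moreover have "1 + \<i> * of_real u \<noteq> 0" by (simp add: complex_eq_iff)
    \<comment> \<open>The relation is between products, so it also holds at frequencies where
      \<open>P 0\<close> vanishes.\<close>
    ultimately show ?thesis
      using arc[of u] by (intro bexI[of _ "\<theta> * ((1 - \<i> * of_real u) / (1 + \<i> * of_real u))"]) (simp_all add: F H)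
  qed
  then obtain \<theta>' where ae: "AE t in ?M. f t = \<theta>' * h t"
    using PR hsq fsq unfolding does_PR_L2_iff by blast
  \<comment> \<open>The first third forces \<open>\<theta>' = - \<theta>\<close> and the middle
    third \<open>\<theta>' = \<theta>\<close>, which is impossible for a unimodular
    \<open>\<theta>\<close>.\<close>
  obtain t where t: "t \<in> {0..<b}" "f t = \<theta>' * h t"
    by (rule exists_AE_point[OF ae, of 0 b]) (use b in auto)
  obtain t' where t': "t' \<in> {b..<2 * b}" "f t' = \<theta>' * h t'"
    by (rule exists_AE_point[OF ae, of b "2 * b"]) (use b in auto)
  have "\<theta>' = \<theta>"
    using t' by (simp add: f_def h_def \<psi>_def indicator_def)
  moreover have "- \<theta> * of_real e = \<theta>' * of_real e"
    using t by (simp add: f_def h_def \<psi>_def indicator_def)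
  then have "- \<theta> = \<theta>'"
    using e by (simp only: mult_cancel_right of_real_eq_0_iff) simp
  ultimately show False
    using \<theta> by simp
qed

theorem theorem1p6:
  fixes a :: real and \<Theta> :: "complex set"
  assumes "a > 0" and "\<Theta> \<subseteq> sphere 0 1" and "\<Theta> \<noteq> {}"
  shows "does_PR \<Theta> (L2 a) (exponential_system a) \<longleftrightarrow>
         totally_disconnected_space (top_of_set \<Theta>)"
  using PR_imp_totally_disconnected totally_disconnected_imp_PR assms by blast

end
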